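(* Let $n\geq k\geq 1$ and let $t\ge 1$ be a divisor of $2nk$. If there exists a relative Heffter array $\mathrm{H}_t(n;k)$, then there also exists a relative non-zero sum Heffter array $\mathrm{NH}_t(n;k)$.
   Context: A partially filled (p.f.) array on a set $\Omega$ is a matrix whose cells are either empty or contain an element of $\Omega$. Let $n\ge k\geq 1$ and let $t\ge 1$ be a divisor of $2nk$; put $v=2nk+t$ and let $J$ be the subgroup of $\mathbb{Z}_v$ of order $t$. Consider an $n\times n$ p.f. array $A$ with elements in $\mathbb{Z}_v$ such that: (a) each row and each column contains exactly $k$ filled cells; (b) the multiset $\{\pm x\mid x\in A\}$ (two elements $x,-x$ for each filled cell with entry $x$) contains each element of $\mathbb{Z}_v\setminus J$ exactly once and no element of $J$. Then $A$ is an $\mathrm{H}_t(n;k)$ if in addition the elements in every row and every column sum to $0$ in $\mathbb{Z}_v$; and $A$ is an $\mathrm{NH}_t(n;k)$ if in addition the sum of the elements in every row and in every column is different from $0$ in $\mathbb{Z}_v$. *)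

theory Defs
  imports "HOL-Number_Theory.Residues" "HOL-Algebra.Elementary_Groups" "HOL-Library.Multiset"
begin

text \<open>
  An n x n partially filled array is a function of type \<open>nat \<Rightarrow> nat \<Rightarrow> 'a option\<close>, with rows and
  columns indexed from 0; cell \<open>(i, j)\<close> is empty iff \<open>A i j = None\<close>, and the values of \<open>A\<close> outside
  \<open>{..<n} \<times> {..<n}\<close> are irrelevant.
\<close>

type_synonym 'a pf_array = "nat \<Rightarrow> nat \<Rightarrow> 'a option"

definition filled_cells :: "nat \<Rightarrow> 'a pf_array \<Rightarrow> (nat \<times> nat) set" where
  "filled_cells n A = {(i, j). i < n \<and> j < n \<and> A i j \<noteq> None}"

definition filled_in_row :: "nat \<Rightarrow> 'a pf_array \<Rightarrow> nat \<Rightarrow> nat set" where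
  "filled_in_row n A i = {j. j < n \<and> A i j \<noteq> None}"

definition filled_in_col :: "nat \<Rightarrow> 'a pf_array \<Rightarrow> nat \<Rightarrow> nat set" where
  "filled_in_col n A j = {i. i < n \<and> A i j \<noteq> None}"

definition entries :: "nat \<Rightarrow> 'a pf_array \<Rightarrow> 'a multiset" where
  "entries n A = image_mset (\<lambda>(i, j). the (A i j)) (mset_set (filled_cells n A))"

definition row_sum :: "('a, 'b) ring_scheme \<Rightarrow> nat \<Rightarrow> 'a pf_array \<Rightarrow> nat \<Rightarrow> 'a" where
  "row_sum R n A i = finsum R (\<lambda>j. the (A i j)) (filled_in_row n A i)"

definition col_sum :: "('a, 'b) ring_scheme \<Rightarrow> nat \<Rightarrow> 'a pf_array \<Rightarrow> nat \<Rightarrow> 'a" where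
  "col_sum R n A j = finsum R (\<lambda>i. the (A i j)) (filled_in_col n A j)"

definition modulus :: "nat \<Rightarrow> nat \<Rightarrow> nat \<Rightarrow> nat" where
  "modulus n k t = 2 * n * k + t"

abbreviation Zmod :: "nat \<Rightarrow> int ring" where
  "Zmod v \<equiv> residue_ring (int v)"

definition subgroup_of_order :: "nat \<Rightarrow> nat \<Rightarrow> int set" where
  "subgroup_of_order v t = (THE J. additive_subgroup J (Zmod v) \<and> card J = t)"

lemma subgroup_of_order_unique:
  assumes "1 < v" "1 \<le> t" "t dvd v"
  shows "\<exists>!J. additive_subgroup J (Zmod v) \<and> card J = t"
    and "subgroup_of_order v t = {x \<in> carrier (Zmod v). int (v div t) dvd x}"
proof -
  define d where "d = v div t"
  have v: "v = d * t" using assms by (simp add: d_def)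
  have d: "d > 0" using v assms by (cases d) auto
  interpret residues "int v" "Zmod v"
    using assms by (simp add: residues_def)
  let ?M = "{x \<in> carrier (Zmod v). int d dvd x}"
  have M_eq: "?M = (\<lambda>i. int d * int i) ` {..<t}"
  proof (intro equalityI subsetI)
    fix x assume "x \<in> ?M"
    then obtain y where y: "x = int d * y" "0 \<le> x" "x < int v" by (auto simp: res_carrier_eq)
    have "0 \<le> y" using y(1,2) d by (simp add: zero_le_mult_iff)
    moreover have "y < int t" using y(1,3) d by (simp add: v)
    ultimately show "x \<in> (\<lambda>i. int d * int i) ` {..<t}"
      using y(1) by (intro image_eqI[of _ _ "nat y"]) auto
  next
    fix x assume "x \<in> (\<lambda>i. int d * int i) ` {..<t}"
    then obtain i where i: "i < t" "x = int d * int i" by auto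
    have "d * i < v" using i d by (simp add: v)
    hence "int (d * i) < int v" by (simp only: of_nat_less_iff)
    then show "x \<in> ?M" using i by (auto simp: res_carrier_eq)
  qed
  have card_M: "card ?M = t"
    unfolding M_eq using d by (subst card_image) (auto simp: inj_on_def)
  have sub_M: "additive_subgroup ?M (Zmod v)"
  proof (rule additive_subgroupI, rule add.subgroupI)
    show "?M \<noteq> {}" using card_M assms by (metis card.empty not_one_le_zero)
    have dv: "int d dvd int v" by (simp add: v)
    show "\<ominus>\<^bsub>Zmod v\<^esub> a \<in> ?M" if "a \<in> ?M" for a
      using that dv assms pos_mod_bound[of "int v" "- a"]
      by (simp add: res_neg_eq res_carrier_eq dvd_mod)
    show "a \<oplus>\<^bsub>Zmod v\<^esub> b \<in> ?M" if "a \<in> ?M" "b \<in> ?M" for a b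
      using that dv assms pos_mod_bound[of "int v" "a + b"]
      by (simp add: res_add_eq res_carrier_eq dvd_mod)
  qed simp
  have uniq: "J = ?M" if J: "additive_subgroup J (Zmod v)" "card J = t" for J
  proof -
    interpret J: additive_subgroup J "Zmod v" by (rule J)
    have pow: "[(m::nat)] \<cdot>\<^bsub>Zmod v\<^esub> x = (int m * x) mod int v" for m x
      by (induction m) (auto simp: add_pow_def nat_pow_def res_zero_eq res_add_eq mod_add_left_eq
          mod_add_right_eq algebra_simps)
    have "J \<subseteq> ?M"
    proof
      fix x assume x: "x \<in> J"
      have grp: "group ((add_monoid (Zmod v))\<lparr>carrier := J\<rparr>)"
        by (rule subgroup.subgroup_is_group[OF J.a_subgroup add.group_axioms])
      have "x [^]\<^bsub>(add_monoid (Zmod v))\<lparr>carrier := J\<rparr>\<^esub> t = \<zero>\<^bsub>Zmod v\<^esub>"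
        using group.pow_order_eq_1[OF grp, of x] x J(2) by (simp add: order_def)
      hence "[t] \<cdot>\<^bsub>Zmod v\<^esub> x = \<zero>\<^bsub>Zmod v\<^esub>"
        by (simp add: nat_pow_def add_pow_def)
      hence "int v dvd int t * x" by (auto simp: pow res_zero_eq)
      hence "int d dvd x" using assms by (simp add: v mult.commute)
      thus "x \<in> ?M" using x J.a_subset by auto
    qed
    moreover have "finite ?M" using card_M assms by (intro card_ge_0_finite) auto
    ultimately show ?thesis using card_M J(2) by (simp add: card_subset_eq)
  qed
  show "\<exists>!J. additive_subgroup J (Zmod v) \<and> card J = t"
    using sub_M card_M uniq by blast
  show "subgroup_of_order v t = {x \<in> carrier (Zmod v). int (v div t) dvd x}"
    unfolding subgroup_of_order_def d_def[symmetric]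
    by (rule the_equality) (fact conjI[OF sub_M card_M], elim conjE, fact uniq)
qed

text \<open>
  The conditions common to both kinds of arrays. The multiset \<open>S\<close> contains, for every filled cell
  with entry \<open>x\<close>, both \<open>x\<close> and \<open>- x\<close>; thus an entry with \<open>x = - x\<close> contributes \<open>x\<close> twice.
\<close>

definition relative_array :: "nat \<Rightarrow> nat \<Rightarrow> nat \<Rightarrow> int pf_array \<Rightarrow> bool" where
  "relative_array n k t A \<longleftrightarrow>
    (let v = modulus n k t; R = Zmod v; J = subgroup_of_order v t;
         S = entries n A + image_mset (\<lambda>x. \<ominus>\<^bsub>R\<^esub> x) (entries n A)
     in set_mset (entries n A) \<subseteq> carrier R \<and>
        (\<forall>i<n. card (filled_in_row n A i) = k) \<and>
        (\<forall>j<n. card (filled_in_col n A j) = k) \<and>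
        (\<forall>x\<in>carrier R - J. count S x = 1) \<and>
        (\<forall>x\<in>J. count S x = 0))"

definition relative_Heffter_array :: "nat \<Rightarrow> nat \<Rightarrow> nat \<Rightarrow> int pf_array \<Rightarrow> bool" where
  "relative_Heffter_array n k t A \<longleftrightarrow>
    relative_array n k t A \<and>
    (let R = Zmod (modulus n k t)
     in (\<forall>i<n. row_sum R n A i = \<zero>\<^bsub>R\<^esub>) \<and> (\<forall>j<n. col_sum R n A j = \<zero>\<^bsub>R\<^esub>))"

definition relative_nonzero_sum_Heffter_array :: "nat \<Rightarrow> nat \<Rightarrow> nat \<Rightarrow> int pf_array \<Rightarrow> bool" where
  "relative_nonzero_sum_Heffter_array n k t A \<longleftrightarrow>
    relative_array n k t A \<and>
    (let R = Zmod (modulus n k t)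
     in (\<forall>i<n. row_sum R n A i \<noteq> \<zero>\<^bsub>R\<^esub>) \<and> (\<forall>j<n. col_sum R n A j \<noteq> \<zero>\<^bsub>R\<^esub>))"

end

theory Submission
  imports Defs
begin

text \<open>
  A \<open>k\<close>-regular bipartite graph has a perfect matching, so some permutation \<open>f\<close> selects one filled
  cell in every row and every column. Negating the selected entries keeps the multiset of all
  \<open>\<plusminus>x\<close> and replaces every vanishing line sum by \<open>-2x\<close>, where \<open>x\<close> is the selected entry of the
  line. This is nonzero, since an entry with \<open>x = -x\<close> would be counted twice.
\<close>

text \<open>Induction on \<open>card I\<close>, split on whether a proper nonempty subfamily is
  tight, i.e. its union has exactly as many elements as it has members. A tight subfamily can be
  matched separately from the rest; if there is none, every proper nonempty subfamily has a spare
  element, so one choice can be made freely.\<close>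

theorem Hall:
  assumes "finite I" and "\<And>i. i \<in> I \<Longrightarrow> finite (S i)"
    and "\<And>J. J \<subseteq> I \<Longrightarrow> card J \<le> card (\<Union>i\<in>J. S i)"
  shows "\<exists>f. inj_on f I \<and> (\<forall>i\<in>I. f i \<in> S i)"
  using assms
proof (induction "card I" arbitrary: I S rule: less_induct)
  case less
  note fin = less.prems(1) and finS = less.prems(2) and hall = less.prems(3)
  have combine: ?case
    if K: "K \<subseteq> I" "K \<noteq> {}" and f: "inj_on f K" "\<And>i. i \<in> K \<Longrightarrow> f i \<in> S i"
      and cond: "\<And>J. J \<subseteq> I - K \<Longrightarrow> card J \<le> card (\<Union>i\<in>J. S i - f ` K)"
    for K f
  proof -
    have "card (I - K) < card I" using K fin by (intro psubset_card_mono) auto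
    then have "\<exists>g. inj_on g (I - K) \<and> (\<forall>i\<in>I - K. g i \<in> S i - f ` K)"
    proof (rule less.hyps)
      show "finite (I - K)" using fin by simp
      show "finite (S i - f ` K)" if "i \<in> I - K" for i using that finS by simp
    qed (rule cond)
    then obtain g where g: "inj_on g (I - K)" "\<And>i. i \<in> I - K \<Longrightarrow> g i \<in> S i - f ` K"
      by blast
    have "f i \<noteq> g j" if "i \<in> K" "j \<in> I - K" for i j
      using g(2) that by (metis DiffD2 imageI)
    then have "inj_on (\<lambda>i. if i \<in> K then f i else g i) I"
      using f(1) g(1) unfolding inj_on_def by (metis DiffI)
    moreover have "\<forall>i\<in>I. (if i \<in> K then f i else g i) \<in> S i" using f g by auto
    ultimately show ?thesis by blast
  qed
  show ?case
  proof (cases "\<exists>K. K \<subset> I \<and> K \<noteq> {} \<and> card (\<Union>i\<in>K. S i) = card K")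
    case True
    then obtain K where K: "K \<subset> I" "K \<noteq> {}" "card (\<Union>i\<in>K. S i) = card K" by blast
    have finK: "finite K" using K fin finite_subset by blast
    have "card K < card I" using K fin psubset_card_mono by blast
    then have "\<exists>f. inj_on f K \<and> (\<forall>i\<in>K. f i \<in> S i)"
    proof (rule less.hyps)
      show "finite (S i)" if "i \<in> K" for i using that K finS by auto
      show "card J \<le> card (\<Union>i\<in>J. S i)" if "J \<subseteq> K" for J using that K by (intro hall) auto
    qed (rule finK)
    then obtain f where f: "inj_on f K" "\<forall>i\<in>K. f i \<in> S i" by blast
    have finU: "finite (\<Union>i\<in>K. S i)" using finK finS K by blast
    \<comment> \<open>Tightness: the injective image already has as many elements as the union
      containing it.\<close>
    have fK: "f ` K = (\<Union>i\<in>K. S i)"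
      using f K(3) finU by (intro card_subset_eq) (auto simp: card_image)
    show ?thesis
    proof (rule combine)
      fix J assume J: "J \<subseteq> I - K"
      have finJ: "finite J" using J fin finite_subset by blast
      have finUJ: "finite (\<Union>i\<in>J. S i - f ` K)" using finJ finS J by blast
      have "card J + card K = card (J \<union> K)" using J finJ finK by (subst card_Un_disjoint) auto
      also have "\<dots> \<le> card (\<Union>i\<in>J \<union> K. S i)" using J K by (intro hall) auto
      also have "(\<Union>i\<in>J \<union> K. S i) = (\<Union>i\<in>J. S i - f ` K) \<union> f ` K" unfolding fK by auto
      also have "card \<dots> \<le> card (\<Union>i\<in>J. S i - f ` K) + card (f ` K)" by (rule card_Un_le)
      finally show "card J \<le> card (\<Union>i\<in>J. S i - f ` K)" by (simp add: fK K(3))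
    qed (use K f in auto)
  next
    case False
    show ?thesis
    proof (cases "I = {}")
      case True
      then show ?thesis by simp
    next
      case False
      then obtain a where a: "a \<in> I" by blast
      have "card {a} \<le> card (S a)" using hall[of "{a}"] a by simp
      then obtain b where b: "b \<in> S a" by fastforce
      show ?thesis
      proof (rule combine[of "{a}" "\<lambda>_. b"])
        fix J assume J: "J \<subseteq> I - {a}"
        show "card J \<le> card (\<Union>i\<in>J. S i - (\<lambda>_. b) ` {a})"
        proof (cases "J = {}")
          case False
          have finJ: "finite J" using J fin finite_subset by blast
          have "finite (\<Union>i\<in>J. S i)" using finJ finS J by blast
          \<comment> \<open>\<open>J\<close> is nonempty and misses \<open>a\<close>, so it is
            proper and not tight. Its union therefore has at least one element to spare, and
            deleting \<open>b\<close> costs at most one.\<close>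
          moreover have "card (\<Union>i\<in>J. S i) \<noteq> card J"
            using \<open>\<nexists>K. K \<subset> I \<and> K \<noteq> {} \<and> card (\<Union>i\<in>K. S i) = card K\<close> False J a by blast
          moreover have "card J \<le> card (\<Union>i\<in>J. S i)" using J by (intro hall) auto
          moreover have "(\<Union>i\<in>J. S i - (\<lambda>_. b) ` {a}) = (\<Union>i\<in>J. S i) - {b}" by auto
          ultimately show ?thesis by (simp add: card_Diff_singleton_if, linarith)
        qed simp
      qed (use a b in auto)
    qed
  qed
qed

text \<open>Hall's condition follows by double counting: the \<open>k * card J\<close> edges leaving
  \<open>J\<close> all end in its neighbourhood \<open>?N\<close>, which meets only
  \<open>k * card ?N\<close> edges, and \<open>k > 0\<close> cancels.\<close>

lemma regular_bipartite_perfect_matching: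
  fixes E :: "'a \<Rightarrow> 'a \<Rightarrow> bool"
  assumes "finite V" "k > 0"
    and row: "\<And>i. i \<in> V \<Longrightarrow> card {j \<in> V. E i j} = k"
    and col: "\<And>j. j \<in> V \<Longrightarrow> card {i \<in> V. E i j} = k"
  shows "\<exists>f. bij_betw f V V \<and> (\<forall>i\<in>V. E i (f i))"
proof -
  let ?S = "\<lambda>i. {j \<in> V. E i j}"
  have "\<exists>f. inj_on f V \<and> (\<forall>i\<in>V. f i \<in> ?S i)"
  proof (rule Hall)
    fix J assume J: "J \<subseteq> V"
    have finJ: "finite J" using J assms(1) finite_subset by blast
    let ?N = "\<Union>i\<in>J. ?S i"
    have finN: "finite ?N" using finJ assms(1) by simp
    have "k * card J = (\<Sum>i\<in>J. card (?S i))" using J row by (simp add: subset_eq)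
    also have "\<dots> = card (SIGMA i:J. ?S i)"
      using finJ assms(1) by (intro card_SigmaI[symmetric]) auto
    \<comment> \<open>The edges meeting \<open>?N\<close> are indexed by their right end;
      \<open>prod.swap\<close> puts them in the same order as the edges leaving \<open>J\<close>, so
      that the inclusion makes sense.\<close>
    also have "\<dots> \<le> card (prod.swap ` (SIGMA j:?N. {i \<in> V. E i j}))"
    proof (rule card_mono)
      show "finite (prod.swap ` (SIGMA j:?N. {i \<in> V. E i j}))"
        using finN assms(1) by (intro finite_imageI finite_SigmaI) auto
    next
      show "(SIGMA i:J. ?S i) \<subseteq> prod.swap ` (SIGMA j:?N. {i \<in> V. E i j})"
        using J by (force simp: image_iff)
    qed
    also have "\<dots> = card (SIGMA j:?N. {i \<in> V. E i j})" by (rule card_image) simp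
    also have "\<dots> = (\<Sum>j\<in>?N. card {i \<in> V. E i j})"
      using finN assms(1) by (intro card_SigmaI) auto
    also have "\<dots> = k * card ?N" using col by simp
    finally show "card J \<le> card ?N" using assms(2) by simp
  qed (use assms(1) in auto)
  then obtain f where f: "inj_on f V" "\<forall>i\<in>V. f i \<in> V \<and> E i (f i)" by auto
  then have "f ` V = V" using assms(1) by (intro endo_inj_surj) auto
  then show ?thesis using f by (auto simp: bij_betw_def)
qed

text \<open>Since the whole sum vanishes, the terms other than \<open>f c\<close> sum to
  \<open>\<ominus> f c\<close>; the negated term contributes a second copy.\<close>

lemma (in abelian_group) finsum_negate_one:
  assumes "finite S" "c \<in> S" "f \<in> S \<rightarrow> carrier G" "finsum G f S = \<zero>"
  shows "finsum G (f(c := \<ominus> f c)) S = \<ominus> f c \<oplus> \<ominus> f c"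
proof -
  have fc: "f c \<in> carrier G" and fS: "f \<in> S - {c} \<rightarrow> carrier G" using assms by auto
  have S: "S = insert c (S - {c})" using assms(2) by blast
  have "f c \<oplus> finsum G f (S - {c}) = \<zero>"
    using assms(1,4) fc fS by (subst (asm) S, subst (asm) finsum_insert) auto
  then have "finsum G f (S - {c}) = \<ominus> f c"
    using fc fS by (metis minus_equality minus_minus finsum_closed)
  moreover have "finsum G (f(c := \<ominus> f c)) S =
      \<ominus> f c \<oplus> finsum G (f(c := \<ominus> f c)) (S - {c})"
    using assms(1) fc fS by (subst S, subst finsum_insert) auto
  moreover have "finsum G (f(c := \<ominus> f c)) (S - {c}) = finsum G f (S - {c})"
    using fS by (intro finsum_cong') auto
  ultimately show ?thesis by simp
qed

text \<open>Each index contributes an unordered pair, and such a pair only swaps its members under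
  negation. As \<open>neg\<close> is arbitrary, the second alternative must itself say that negating
  again leads back to \<open>g c\<close>.\<close>

lemma negate_some_plus_minus_mset:
  assumes "\<And>c. c \<in># M \<Longrightarrow> h c = g c \<or> h c = neg (g c) \<and> neg (h c) = g c"
  shows "image_mset h M + image_mset neg (image_mset h M) =
         image_mset g M + image_mset neg (image_mset g M)"
  using assms
proof (induction M)
  case (add c M)
  then have "h c = g c \<or> h c = neg (g c) \<and> neg (h c) = g c" by simp
  then have "{#h c, neg (h c)#} = {#g c, neg (g c)#}" by (auto simp: add_mset_commute)
  with add show ?case by (simp add: add_mset_commute)
qed simp

theorem theorem3p4:
  fixes n k t :: nat
  assumes "1 \<le> k" "k \<le> n" "1 \<le> t" "t dvd 2 * n * k"
    and "\<exists>A. relative_Heffter_array n k t A"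
  shows "\<exists>A. relative_nonzero_sum_Heffter_array n k t A"
proof -
  obtain A where A: "relative_Heffter_array n k t A" using assms(5) by blast
  define v where "v = modulus n k t"
  define R where "R = Zmod v"
  have "0 < n * k" using assms by auto
  then have "v > 1" using assms(3) unfolding v_def modulus_def mult.assoc by linarith
  then interpret residues "int v" R by unfold_locales (simp_all add: R_def)
  define J where "J = subgroup_of_order v t"
  define S where "S = entries n A + image_mset (\<lambda>x. \<ominus>\<^bsub>R\<^esub> x) (entries n A)"
  have carr: "set_mset (entries n A) \<subseteq> carrier R"
    and rowk: "\<And>i. i < n \<Longrightarrow> card (filled_in_row n A i) = k"
    and colk: "\<And>j. j < n \<Longrightarrow> card (filled_in_col n A j) = k"
    and S1: "\<forall>x\<in>carrier R - J. count S x = 1" and S0: "\<forall>x\<in>J. count S x = 0"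
    and row0: "\<And>i. i < n \<Longrightarrow> row_sum R n A i = \<zero>\<^bsub>R\<^esub>"
    and col0: "\<And>j. j < n \<Longrightarrow> col_sum R n A j = \<zero>\<^bsub>R\<^esub>"
    using A unfolding relative_Heffter_array_def relative_array_def Let_def
      v_def R_def J_def S_def by auto
  have fin: "finite (filled_cells n A)"
    by (rule finite_subset[of _ "{..<n} \<times> {..<n}"]) (auto simp: filled_cells_def)
  have entry: "the (A i j) \<in># entries n A" if "i < n" "j < n" "A i j \<noteq> None" for i j
  proof -
    have "(i, j) \<in> filled_cells n A" using that by (simp add: filled_cells_def)
    then show ?thesis using fin unfolding entries_def by force
  qed
  have nz: "\<ominus>\<^bsub>R\<^esub> x \<oplus>\<^bsub>R\<^esub> \<ominus>\<^bsub>R\<^esub> x \<noteq> \<zero>\<^bsub>R\<^esub>" if x: "x \<in># entries n A" for x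
  proof
    assume eq: "\<ominus>\<^bsub>R\<^esub> x \<oplus>\<^bsub>R\<^esub> \<ominus>\<^bsub>R\<^esub> x = \<zero>\<^bsub>R\<^esub>"
    have xc: "x \<in> carrier R" using x carr by blast
    then have "\<ominus>\<^bsub>R\<^esub> x = x" using eq by (metis minus_equality minus_minus a_inv_closed)
    then have "x \<in># image_mset (\<lambda>x. \<ominus>\<^bsub>R\<^esub> x) (entries n A)" using x by force
    \<comment> \<open>One occurrence comes from each summand of \<open>S\<close>, whereas the count
      is 0 on \<open>J\<close> and 1 on the rest of the carrier.\<close>
    then have "count S x \<ge> 1 + 1"
      using x unfolding S_def count_union by (intro add_mono) (simp_all add: Suc_le_eq)
    then show False using S1 S0 xc by (cases "x \<in> J") auto
  qed
  \<comment> \<open>Rows and columns are the two sides of the graph, and filled cells are its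
    edges.\<close>
  obtain f where bij: "bij_betw f {..<n} {..<n}" and f: "\<And>i. i < n \<Longrightarrow> A i (f i) \<noteq> None"
    using regular_bipartite_perfect_matching[of "{..<n}" k "\<lambda>i j. A i j \<noteq> None"]
      rowk colk assms(1) by (auto simp: filled_in_row_def filled_in_col_def)
  have fless: "f i < n" if "i < n" for i using bij that by (auto simp: bij_betw_def)
  \<comment> \<open>\<open>map_option\<close> keeps empty cells empty for all indices, so
    \<open>A\<close> and \<open>B\<close> have the same filled cells without any bound on
    \<open>i\<close> and \<open>j\<close>.\<close>
  define B where "B = (\<lambda>i j. if j = f i then map_option (\<lambda>x. \<ominus>\<^bsub>R\<^esub> x) (A i j) else A i j)"
  have None_iff: "B i j = None \<longleftrightarrow> A i j = None" for i j by (simp add: B_def)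
  have B_rows: "filled_in_row n B i = filled_in_row n A i" for i
    by (simp add: filled_in_row_def None_iff)
  have B_cols: "filled_in_col n B j = filled_in_col n A j" for j
    by (simp add: filled_in_col_def None_iff)
  have B_cells: "filled_cells n B = filled_cells n A" by (simp add: filled_cells_def None_iff)
  \<comment> \<open>Double negation cancels because entries lie in the carrier of reduced
    residues.\<close>
  have B_entry: "the (B i j) = the (A i j) \<or>
      the (B i j) = \<ominus>\<^bsub>R\<^esub> the (A i j) \<and> \<ominus>\<^bsub>R\<^esub> the (B i j) = the (A i j)"
    "the (B i j) \<in> carrier R"
    if "i < n" "j < n" "A i j \<noteq> None" for i j
  proof -
    have "the (A i j) \<in> carrier R" using entry[OF that] carr by blast
    then show "the (B i j) = the (A i j) \<or>
        the (B i j) = \<ominus>\<^bsub>R\<^esub> the (A i j) \<and> \<ominus>\<^bsub>R\<^esub> the (B i j) = the (A i j)"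
      "the (B i j) \<in> carrier R"
      using that(3) by (auto simp: B_def)
  qed
  have S_B: "entries n B + image_mset (\<lambda>x. \<ominus>\<^bsub>R\<^esub> x) (entries n B) = S"
    unfolding S_def entries_def B_cells
    by (rule negate_some_plus_minus_mset) (use fin B_entry in \<open>auto simp: filled_cells_def\<close>)
  have B_carr: "set_mset (entries n B) \<subseteq> carrier R"
    using fin B_entry(2) unfolding entries_def B_cells by (auto simp: filled_cells_def)
  have rel: "relative_array n k t B"
    using B_carr rowk colk S1 S0
    unfolding relative_array_def Let_def v_def[symmetric] R_def[symmetric] J_def[symmetric]
      S_B B_rows B_cols by blast
  have "row_sum R n B i \<noteq> \<zero>\<^bsub>R\<^esub>" if i: "i < n" for i
  proof -
    let ?g = "\<lambda>j. the (A i j)" and ?F = "filled_in_row n A i"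
    have g: "?g \<in> ?F \<rightarrow> carrier R" using entry carr i by (auto simp: filled_in_row_def)
    have c: "f i \<in> ?F" using i f fless by (simp add: filled_in_row_def)
    have "row_sum R n B i = finsum R (?g(f i := \<ominus>\<^bsub>R\<^esub> ?g (f i))) ?F"
      unfolding row_sum_def B_rows using f[OF i] funcset_mem[OF g c]
      by (intro finsum_cong') (auto simp: B_def intro: funcset_mem[OF g])
    also have "\<dots> = \<ominus>\<^bsub>R\<^esub> ?g (f i) \<oplus>\<^bsub>R\<^esub> \<ominus>\<^bsub>R\<^esub> ?g (f i)"
      using row0[OF i] g c
      by (intro finsum_negate_one) (simp_all add: row_sum_def, simp add: filled_in_row_def)
    also have "\<dots> \<noteq> \<zero>\<^bsub>R\<^esub>" using i f fless entry by (intro nz) auto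
    finally show ?thesis .
  qed
  moreover have "col_sum R n B j \<noteq> \<zero>\<^bsub>R\<^esub>" if j: "j < n" for j
  proof -
    let ?g = "\<lambda>i. the (A i j)" and ?F = "filled_in_col n A j"
    \<comment> \<open>Surjectivity of \<open>f\<close> gives a negated cell in column
      \<open>j\<close>; injectivity makes it the only one.\<close>
    obtain i where i: "i < n" "f i = j" using bij j by (metis bij_betw_iff_bijections lessThan_iff)
    have inj: "f i' = j \<longleftrightarrow> i' = i" if "i' \<in> ?F" for i'
      using bij i that by (auto simp: bij_betw_def inj_on_def filled_in_col_def)
    have g: "?g \<in> ?F \<rightarrow> carrier R" using entry carr j by (auto simp: filled_in_col_def)
    have c: "i \<in> ?F" using i f by (auto simp: filled_in_col_def)
    have "col_sum R n B j = finsum R (?g(i := \<ominus>\<^bsub>R\<^esub> ?g i)) ?F"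
      unfolding col_sum_def B_cols
    proof (rule finsum_cong')
      show "?g(i := \<ominus>\<^bsub>R\<^esub> ?g i) \<in> ?F \<rightarrow> carrier R"
        using funcset_mem[OF g c] by (auto intro: funcset_mem[OF g])
      show "the (B i' j) = (?g(i := \<ominus>\<^bsub>R\<^esub> ?g i)) i'" if "i' \<in> ?F" for i'
      proof (cases "i' = i")
        case True
        have "A i j \<noteq> None" using f[OF i(1)] by (simp only: i(2) not_False_eq_True)
        then show ?thesis unfolding True B_def i(2) by (simp add: option.map_sel)
      next
        case False
        then have "j \<noteq> f i'" using inj[OF that] by metis
        then show ?thesis using False by (simp add: B_def)
      qed
    qed simp
    also have "\<dots> = \<ominus>\<^bsub>R\<^esub> ?g i \<oplus>\<^bsub>R\<^esub> \<ominus>\<^bsub>R\<^esub> ?g i"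
      using col0[OF j] g c
      by (intro finsum_negate_one) (simp_all add: col_sum_def, simp add: filled_in_col_def)
    also have "\<dots> \<noteq> \<zero>\<^bsub>R\<^esub>" using i j f entry by (intro nz) auto
    finally show ?thesis .
  qed
  ultimately have "relative_nonzero_sum_Heffter_array n k t B"
    using rel unfolding relative_nonzero_sum_Heffter_array_def Let_def v_def R_def by blast
  then show ?thesis by blast
qed

end
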